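(* Let $\{a_k\}_{k\ge 1}$ be an arbitrary sequence of positive numbers, let $A_k=\sum_{i=1}^k a_i$ (so $A_0=0$), and let the contracting coefficients be $\gamma_k=\frac{a_{k+1}}{A_{k+1}}$ for $k\ge 0$. Let $\{x_k\}_{k\ge 0}$ and the test points $\{\bar x_k\}_{k\ge 1}$ be generated by the Conceptual Contracting-Point Method II (described in the context) with these coefficients and with tolerances $\delta_{k+1}\ge 0$, $k\ge0$. Define $$\varphi_k(v)=\sum_{i=1}^k a_i\bigl[f(\bar x_i)+\langle\nabla f(\bar x_i),v-\bar x_i\rangle+\psi(v)\bigr],\qquad \varphi_k^*=\min_{v\in\mathrm{dom}\,\psi}\varphi_k(v),\qquad B_k=\sum_{i=1}^k A_i\delta_i$$ (with $\varphi_0\equiv 0$ and $B_0=0$). Then $$\varphi_k^*\;\ge\; A_kF(x_k)-B_k,\qquad k\ge 0.$$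
   Context: Setting. $\mathbb{E}$ is a finite-dimensional real vector space with dual $\mathbb{E}^*$; $\langle s,x\rangle$ is the value of $s\in\mathbb{E}^*$ at $x\in\mathbb{E}$. The problem is $F^*=\min_{x\in\mathrm{dom}\,\psi}[F(x)=f(x)+\psi(x)]$, where $\psi:\mathbb{E}\to\mathbb{R}\cup\{+\infty\}$ is a proper closed convex function with bounded domain $\mathrm{dom}\,\psi=\{x:\psi(x)<+\infty\}$, and $f$ is convex and $p\ge 1$ times continuously differentiable at every point of $\mathrm{dom}\,\psi$. Conceptual Contracting-Point Method II. Choose $x_0\in\mathrm{dom}\,\psi$. At iteration $k\ge 0$: (1) choose $\gamma_k\in(0,1]$; (2) for some $\delta_{k+1}\ge 0$ find a point $\bar x_{k+1}=(1-\gamma_k)x_k+\gamma_k\bar v_{k+1}$ with $\bar v_{k+1}\in\mathrm{dom}\,\psi$ such that $$\langle\nabla f(\bar x_{k+1}),v-\bar v_{k+1}\rangle+\psi(v)\ge\psi(\bar v_{k+1})-\tfrac{1}{\gamma_k}\delta_{k+1}\quad\text{for all }v\in\mathrm{dom}\,\psi;$$ (3) if $F(\bar x_{k+1})\le F(x_k)$ set $x_{k+1}=\bar x_{k+1}$, else set $x_{k+1}=x_k$. *)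

theory Defs
  imports "HOL-Analysis.Analysis"
begin

definition edom :: "('a \<Rightarrow> ereal) \<Rightarrow> 'a set" where
  "edom \<psi> = {x. \<psi> x < \<infinity>}"

definition ereal_epigraph :: "('a \<Rightarrow> ereal) \<Rightarrow> ('a \<times> real) set" where
  "ereal_epigraph \<psi> = {(x, r). \<psi> x \<le> ereal r}"

text \<open>Functions with values in the reals extended by plus infinity; closedness and convexity
  are those of the epigraph.\<close>

definition proper_closed_convex :: "('a::real_normed_vector \<Rightarrow> ereal) \<Rightarrow> bool" where
  "proper_closed_convex \<psi> \<longleftrightarrow>
     (\<forall>x. \<psi> x \<noteq> -\<infinity>) \<and> edom \<psi> \<noteq> {} \<and>
     closed (ereal_epigraph \<psi>) \<and> convex (ereal_epigraph \<psi>)"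

text \<open>Here \<open>cont_diff_at p f x\<close> says that \<open>f\<close> is \<open>p\<close> times differentiable near \<open>x\<close> with
  \<open>p\<close>-th derivative continuous at \<open>x\<close>. Higher derivatives are
  taken through directional derivatives, which keeps the type of \<open>f\<close> fixed along the
  recursion; in finite dimension this agrees with iterating the Frechet derivative.\<close>

primrec cont_diff_at :: "nat \<Rightarrow> ('a::euclidean_space \<Rightarrow> real) \<Rightarrow> 'a \<Rightarrow> bool" where
  "cont_diff_at 0 f x \<longleftrightarrow> isCont f x"
| "cont_diff_at (Suc p) f x \<longleftrightarrow>
     (\<forall>\<^sub>F y in nhds x. f differentiable (at y)) \<and>
     (\<forall>h. cont_diff_at p (\<lambda>y. frechet_derivative f (at y) h) x)"

text \<open>The pairing of the gradient of \<open>f\<close> at \<open>x\<close>, an element of the dual space, with a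
  vector \<open>h\<close>; no inner product is involved.\<close>

definition grad_pairing :: "('a::euclidean_space \<Rightarrow> real) \<Rightarrow> 'a \<Rightarrow> 'a \<Rightarrow> real" where
  "grad_pairing f x h = frechet_derivative f (at x) h"

definition objective :: "('a \<Rightarrow> real) \<Rightarrow> ('a \<Rightarrow> ereal) \<Rightarrow> 'a \<Rightarrow> ereal" where
  "objective f \<psi> x = ereal (f x) + \<psi> x"

text \<open>The sequences \<open>\<delta>\<close> and \<open>xbar\<close> are used only at indices \<open>\<ge> 1\<close>.\<close>

definition contracting_point_II ::
  "('a::euclidean_space \<Rightarrow> real) \<Rightarrow> ('a \<Rightarrow> ereal) \<Rightarrow> (nat \<Rightarrow> real) \<Rightarrow> (nat \<Rightarrow> real) \<Rightarrow>
   (nat \<Rightarrow> 'a) \<Rightarrow> (nat \<Rightarrow> 'a) \<Rightarrow> bool" where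
  "contracting_point_II f \<psi> \<gamma> \<delta> x xbar \<longleftrightarrow>
     x 0 \<in> edom \<psi> \<and>
     (\<forall>k. 0 < \<gamma> k \<and> \<gamma> k \<le> 1 \<and> 0 \<le> \<delta> (Suc k) \<and>
        (\<exists>vbar \<in> edom \<psi>.
           xbar (Suc k) = (1 - \<gamma> k) *\<^sub>R x k + \<gamma> k *\<^sub>R vbar \<and>
           (\<forall>v \<in> edom \<psi>.
              ereal (grad_pairing f (xbar (Suc k)) (v - vbar)) + \<psi> v
                \<ge> \<psi> vbar - ereal (1 / \<gamma> k * \<delta> (Suc k)))) \<and>
        x (Suc k) =
          (if objective f \<psi> (xbar (Suc k)) \<le> objective f \<psi> (x k) then xbar (Suc k) else x k))"

definition A_sum :: "(nat \<Rightarrow> real) \<Rightarrow> nat \<Rightarrow> real" where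
  "A_sum a k = (\<Sum>i=1..k. a i)"

definition B_sum :: "(nat \<Rightarrow> real) \<Rightarrow> (nat \<Rightarrow> real) \<Rightarrow> nat \<Rightarrow> real" where
  "B_sum a \<delta> k = (\<Sum>i=1..k. A_sum a i * \<delta> i)"

definition phi ::
  "('a::euclidean_space \<Rightarrow> real) \<Rightarrow> ('a \<Rightarrow> ereal) \<Rightarrow> (nat \<Rightarrow> real) \<Rightarrow> (nat \<Rightarrow> 'a) \<Rightarrow>
   nat \<Rightarrow> 'a \<Rightarrow> ereal" where
  "phi f \<psi> a xbar k v =
     (\<Sum>i=1..k. ereal (a i) *
        (ereal (f (xbar i) + grad_pairing f (xbar i) (v - xbar i)) + \<psi> v))"

text \<open>An infimum by definition; that it is a minimum has to be stated separately.\<close>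

definition phi_star ::
  "('a::euclidean_space \<Rightarrow> real) \<Rightarrow> ('a \<Rightarrow> ereal) \<Rightarrow> (nat \<Rightarrow> real) \<Rightarrow> (nat \<Rightarrow> 'a) \<Rightarrow>
   nat \<Rightarrow> ereal" where
  "phi_star f \<psi> a xbar k = (INF v \<in> edom \<psi>. phi f \<psi> a xbar k v)"

end

theory Submission imports Defs begin

text \<open>Everything reduces to the real-valued restriction of \<open>\<psi>\<close> to its domain. The minimum of
  \<open>\<phi>\<^sub>k\<close> is attained because its sublevel sets are sections of the closed epigraph of \<open>\<psi>\<close>,
  hence nested compact sets. The bound \<open>\<phi>\<^sub>k v \<ge> A\<^sub>k F(x\<^sub>k) - B\<^sub>k\<close> is shown for every \<open>v\<close> by
  induction on \<open>k\<close>: since \<open>A\<^sub>k\<^sub>+\<^sub>1 xbar\<^sub>k\<^sub>+\<^sub>1 = A\<^sub>k x\<^sub>k + a\<^sub>k\<^sub>+\<^sub>1 vbar\<^sub>k\<^sub>+\<^sub>1\<close>, linearising \<open>f\<close> at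
  \<open>xbar\<^sub>k\<^sub>+\<^sub>1\<close>, both at \<open>x\<^sub>k\<close> and in the new term of \<open>\<phi>\<^sub>k\<^sub>+\<^sub>1\<close>, leaves only the gradient
  paired with \<open>v - vbar\<^sub>k\<^sub>+\<^sub>1\<close>, which the inexact optimality condition controls.\<close>

text \<open>The infimum may a priori be \<open>-\<infinity>\<close>, so compactness is applied to
  the sublevel sets at real levels strictly above it. A point common to all of them has a value at
  most every such level, hence at most the infimum. \<open>D\<close> itself is not assumed
  closed.\<close>

lemma attains_INF_if_closed_sublevels:
  fixes h :: "'a::heine_borel \<Rightarrow> ereal"
  assumes ne: "D \<noteq> {}" and bdd: "bounded D" and fin: "\<And>v. v \<in> D \<Longrightarrow> h v < \<infinity>"
    and cl: "\<And>c. closed {v \<in> D. h v \<le> ereal c}"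
  shows "\<exists>v\<in>D. h v = (INF v\<in>D. h v)"
proof -
  define m where "m = (INF v\<in>D. h v)"
  define C where "C = {c. m < ereal c}"
  define S where "S c = {v \<in> D. h v \<le> ereal c}" for c
  obtain v0 where v0: "v0 \<in> D" using ne by blast
  have "m < \<infinity>"
    using fin[OF v0] INF_lower[OF v0, of h] unfolding m_def by (rule le_less_trans[rotated])
  then obtain c0 where c0: "c0 \<in> C"
    unfolding C_def using less_PInf_Ex_of_nat ereal_dense2 by blast
  have comp: "compact (S c)" for c
    unfolding S_def by (metis (no_types, lifting) bdd bounded_subset cl compact_eq_bounded_closed mem_Collect_eq subsetI)
  have ne_S: "S c \<noteq> {}" if "c \<in> C" for c
    using that unfolding S_def C_def m_def by (auto simp: INF_less_iff intro: less_imp_le)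
  have "S c0 \<inter> (\<Inter>c\<in>C. S c) \<noteq> {}"
  proof (rule compact_imp_fip_image)
    show "compact (S c0)" by (rule comp)
    show "closed (S c)" if "c \<in> C" for c
      unfolding S_def by (rule cl)
    show "S c0 \<inter> (\<Inter>c\<in>I. S c) \<noteq> {}" if "finite I" "I \<subseteq> C" for I
    proof -
      \<comment> \<open>The sublevel set of the least level lies in all the others, so it bounds the
        finite intersection from below; inserting \<open>c0\<close> covers the factor
        \<open>S c0\<close> and the case of empty \<open>I\<close>.\<close>
      have "Min (insert c0 I) \<in> C"
        using that c0 Min_in[of "insert c0 I"] by auto
      moreover have "S (Min (insert c0 I)) \<subseteq> S c" if "c \<in> insert c0 I" for c
      proof -
        have "ereal (Min (insert c0 I)) \<le> ereal c"
          using that \<open>finite I\<close> by (simp add: Min_le)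
        then show ?thesis unfolding S_def by (auto intro: order_trans)
      qed
      ultimately show ?thesis using ne_S by blast
    qed
  qed
  then obtain v where v: "v \<in> D" "\<And>c. c \<in> C \<Longrightarrow> h v \<le> ereal c"
    unfolding S_def by auto
  have "h v \<le> m"
  proof (rule dense_ge)
    fix y assume "m < y"
    then obtain c where "m < ereal c" "ereal c < y" using ereal_dense2 by blast
    then show "h v \<le> y" using v(2)[of c] by (auto simp: C_def)
  qed
  moreover have "m \<le> h v" unfolding m_def using v(1) by (rule INF_lower)
  ultimately have "h v = m" by (rule antisym)
  then show ?thesis using v(1) unfolding m_def by blast
qed

text \<open>Convexity is available only on \<open>S\<close>, so only the segment from
  \<open>x\<close> to \<open>y\<close> is used: there it bounds the difference quotients for
  \<open>0 < t < 1\<close> by \<open>f y - f x\<close>, and these tend to \<open>D (y - x)\<close>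
  as \<open>t\<close> decreases to 0.\<close>

lemma convex_on_ge_tangent:
  assumes f: "convex_on S f" and der: "(f has_derivative D) (at x)"
    and x: "x \<in> S" and y: "y \<in> S"
  shows "f x + D (y - x) \<le> f y"
proof -
  define g where "g t = f (x + t *\<^sub>R (y - x))" for t :: real
  have "((\<lambda>t. x + t *\<^sub>R (y - x)) has_derivative (\<lambda>t. t *\<^sub>R (y - x))) (at 0)"
    by (auto intro!: derivative_eq_intros)
  moreover have "(f has_derivative D) (at (x + 0 *\<^sub>R (y - x)))" using der by simp
  ultimately have "(g has_derivative (\<lambda>t. D (t *\<^sub>R (y - x)))) (at 0)"
    unfolding g_def by (rule has_derivative_compose)
  moreover have "(\<lambda>t. D (t *\<^sub>R (y - x))) = (\<lambda>t. D (y - x) * t)"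
    using linear_cmul[OF has_derivative_linear[OF der]] by auto
  ultimately have "(g has_real_derivative D (y - x)) (at 0)"
    by (simp add: has_field_derivative_def)
  then have lim: "((\<lambda>t. (g t - g 0) / t) \<longlongrightarrow> D (y - x)) (at_right 0)"
    by (auto simp: has_field_derivative_iff intro: filterlim_at_split[THEN iffD1, THEN conjunct2])
  have "(g t - g 0) / t \<le> f y - f x" if t: "0 < t" "t < 1" for t
  proof -
    have "g t = f ((1 - t) *\<^sub>R x + t *\<^sub>R y)" by (simp add: g_def algebra_simps)
    also have "\<dots> \<le> (1 - t) * f x + t * f y"
      using f t x y by (intro convex_onD) auto
    finally have "g t - g 0 \<le> t * (f y - f x)" by (simp add: g_def algebra_simps)
    then show ?thesis using t by (simp add: field_simps)
  qed
  then have "\<forall>\<^sub>F t in at_right 0. (g t - g 0) / t \<le> f y - f x"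
    by (auto simp: eventually_at_right_field intro: exI[of _ 1])
  then have "D (y - x) \<le> f y - f x"
    by (intro tendsto_upperbound[OF lim]) auto
  then show ?thesis by simp
qed

lemma proper_closed_convex_ereal_real:
  assumes "proper_closed_convex \<psi>" "v \<in> edom \<psi>"
  shows "\<psi> v = ereal (real_of_ereal (\<psi> v))"
  using assms by (cases "\<psi> v") (auto simp: proper_closed_convex_def edom_def)

text \<open>Both claims come from combining the graph points over \<open>u\<close> and
  \<open>v\<close> inside the convex epigraph: the resulting real upper bound puts the combination
  in the domain, and only then can the inequality be read in the reals.\<close>

lemma proper_closed_convex_combination:
  assumes psi: "proper_closed_convex \<psi>" and u: "u \<in> edom \<psi>" and v: "v \<in> edom \<psi>"
    and t: "0 \<le> t" "t \<le> 1"
  shows "(1 - t) *\<^sub>R u + t *\<^sub>R v \<in> edom \<psi>"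
    and "real_of_ereal (\<psi> ((1 - t) *\<^sub>R u + t *\<^sub>R v))
      \<le> (1 - t) * real_of_ereal (\<psi> u) + t * real_of_ereal (\<psi> v)"
proof -
  let ?w = "(1 - t) *\<^sub>R u + t *\<^sub>R v"
  let ?r = "(1 - t) * real_of_ereal (\<psi> u) + t * real_of_ereal (\<psi> v)"
  have "(u, real_of_ereal (\<psi> u)) \<in> ereal_epigraph \<psi>" "(v, real_of_ereal (\<psi> v)) \<in> ereal_epigraph \<psi>"
    using proper_closed_convex_ereal_real[OF psi u] proper_closed_convex_ereal_real[OF psi v]
    by (auto simp: ereal_epigraph_def)
  moreover have "convex (ereal_epigraph \<psi>)" using psi by (simp add: proper_closed_convex_def)
  ultimately have "(1 - t) *\<^sub>R (u, real_of_ereal (\<psi> u)) + t *\<^sub>R (v, real_of_ereal (\<psi> v)) \<in> ereal_epigraph \<psi>"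
    using t by (intro convexD) auto
  then have le: "\<psi> ?w \<le> ereal ?r" by (simp add: ereal_epigraph_def)
  then show w: "?w \<in> edom \<psi>" by (auto simp: edom_def le_less_trans)
  show "real_of_ereal (\<psi> ?w) \<le> ?r"
    using le proper_closed_convex_ereal_real[OF psi w] by (metis ereal_less_eq(3))
qed

text \<open>Solving the inequality for \<psi>, which takes \<open>A > 0\<close>, exhibits the set as
  the preimage of the closed epigraph under a continuous map. Thus it is closed even when
  \<open>edom \<psi>\<close> is not.\<close>

lemma closed_sublevel_add_scaled:
  fixes L :: "'a::real_normed_vector \<Rightarrow> real"
  assumes psi: "proper_closed_convex \<psi>" and L: "continuous_on UNIV L" and A: "A > 0"
  shows "closed {v \<in> edom \<psi>. ereal (L v + A * real_of_ereal (\<psi> v)) \<le> ereal c}"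
proof -
  have "{v \<in> edom \<psi>. ereal (L v + A * real_of_ereal (\<psi> v)) \<le> ereal c}
      = (\<lambda>v. (v, (c - L v) / A)) -` ereal_epigraph \<psi>" (is "?S = ?T")
  proof (rule set_eqI)
    fix v
    have *: "\<psi> v \<le> ereal r \<longleftrightarrow> v \<in> edom \<psi> \<and> real_of_ereal (\<psi> v) \<le> r" for r
      using psi by (cases "\<psi> v") (auto simp: edom_def proper_closed_convex_def)
    show "v \<in> ?S \<longleftrightarrow> v \<in> ?T"
      unfolding vimage_def ereal_epigraph_def using A by (simp add: * field_simps)
  qed
  moreover have "closed (ereal_epigraph \<psi>)" using psi by (simp add: proper_closed_convex_def)
  ultimately show ?thesis
    using A by (auto intro!: closed_vimage continuous_intros L)
qed

lemma cont_diff_at_grad_pairing: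
  assumes "cont_diff_at p f y" "p \<ge> 1"
  shows "(f has_derivative grad_pairing f y) (at y)"
proof -
  obtain q where "p = Suc q" using assms(2) by (cases p) auto
  then have "\<forall>\<^sub>F z in nhds y. f differentiable (at z)" using assms(1) by simp
  then have "f differentiable (at y)" by (rule eventually_nhds_x_imp_x)
  then show ?thesis
    unfolding grad_pairing_def by (simp add: frechet_derivative_works)
qed

lemma phi_eq_real:
  assumes "\<psi> v = ereal r"
  shows "phi f \<psi> a xbar k v =
    ereal ((\<Sum>i=1..k. a i * (f (xbar i) + grad_pairing f (xbar i) (v - xbar i))) + A_sum a k * r)"
proof -
  have "phi f \<psi> a xbar k v =
      (\<Sum>i=1..k. ereal (a i * (f (xbar i) + grad_pairing f (xbar i) (v - xbar i) + r)))"
    by (simp add: phi_def assms)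
  then show ?thesis
    by (simp add: A_sum_def sum_distrib_right sum.distrib distrib_left)
qed

lemma phi_attains_phi_star:
  assumes psi: "proper_closed_convex \<psi>" and bdd: "bounded (edom \<psi>)"
    and lin: "\<And>i. i \<ge> 1 \<Longrightarrow> bounded_linear (grad_pairing f (xbar i))"
    and A: "A_sum a k > 0"
  shows "\<exists>v\<in>edom \<psi>. phi f \<psi> a xbar k v = phi_star f \<psi> a xbar k"
proof -
  define L where "L v = (\<Sum>i=1..k. a i * (f (xbar i) + grad_pairing f (xbar i) (v - xbar i)))" for v
  have eq: "phi f \<psi> a xbar k v = ereal (L v + A_sum a k * real_of_ereal (\<psi> v))"
    if "v \<in> edom \<psi>" for v
    unfolding L_def by (rule phi_eq_real, rule proper_closed_convex_ereal_real[OF psi that])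
  have "continuous_on UNIV L"
    unfolding L_def
    by (intro continuous_intros bounded_linear.continuous_on[OF lin]) auto
  then have "closed {v \<in> edom \<psi>. ereal (L v + A_sum a k * real_of_ereal (\<psi> v)) \<le> ereal c}" for c
    using psi A by (intro closed_sublevel_add_scaled)
  then have cl: "closed {v \<in> edom \<psi>. phi f \<psi> a xbar k v \<le> ereal c}" for c
    using eq by (simp cong: conj_cong)
  have "edom \<psi> \<noteq> {}" using psi by (simp add: proper_closed_convex_def)
  then show ?thesis
    unfolding phi_star_def
    by (rule attains_INF_if_closed_sublevels[OF _ bdd _ cl]) (simp add: eq)
qed

theorem theorem2:
  fixes f :: "'a::euclidean_space \<Rightarrow> real"
    and \<psi> :: "'a \<Rightarrow> ereal"
    and p :: nat
    and a \<delta> \<gamma> :: "nat \<Rightarrow> real"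
    and x xbar :: "nat \<Rightarrow> 'a"
  assumes psi: "proper_closed_convex \<psi>"
    and bounded_dom: "bounded (edom \<psi>)"
    and f_convex: "convex_on (edom \<psi>) f"
    and p_ge_1: "p \<ge> 1"
    and f_smooth: "\<forall>y \<in> edom \<psi>. cont_diff_at p f y"
    and a_pos: "\<forall>k\<ge>1. a k > 0"
    and gamma: "\<forall>k. \<gamma> k = a (Suc k) / A_sum a (Suc k)"
    and seq: "contracting_point_II f \<psi> \<gamma> \<delta> x xbar"
  shows "\<forall>k. (\<exists>v \<in> edom \<psi>. phi f \<psi> a xbar k v = phi_star f \<psi> a xbar k) \<and>
    phi_star f \<psi> a xbar k \<ge> ereal (A_sum a k) * objective f \<psi> (x k) - ereal (B_sum a \<delta> k)"
proof -
  \<comment> \<open>Since \<open>real_of_ereal\<close> sends infinity to 0, \<open>r\<close> and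
    \<open>P\<close> represent \<psi> and \<open>phi\<close> only on \<open>edom \<psi>\<close>;
    this is why \<open>x\<close>, \<open>xbar\<close> and \<open>vbar\<close> are all placed in the
    domain.\<close>
  define r where "r v = real_of_ereal (\<psi> v)" for v
  define G where "G i = grad_pairing f (xbar i)" for i
  define P where "P k v = (\<Sum>i=1..k. a i * (f (xbar i) + G i (v - xbar i))) + A_sum a k * r v" for k v
  have psi_r: "\<psi> v = ereal (r v)" if "v \<in> edom \<psi>" for v
    unfolding r_def using psi that by (rule proper_closed_convex_ereal_real)
  have A_Suc: "A_sum a (Suc k) = A_sum a k + a (Suc k)" for k by (simp add: A_sum_def)
  have A_nonneg: "A_sum a k \<ge> 0" for k
    unfolding A_sum_def using a_pos by (intro sum_nonneg) (auto intro: less_imp_le)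
  have a_Suc: "a (Suc k) > 0" for k using a_pos by simp
  have A_pos: "A_sum a (Suc k) > 0" for k
    using A_nonneg[of k] a_Suc[of k] by (simp add: A_Suc)
  have g: "0 < \<gamma> k" "\<gamma> k \<le> 1" for k
    using seq by (auto simp: contracting_point_II_def)
  \<comment> \<open>Scaled by the new total weight, the coefficients of the contraction step become
    the old total and the new weight. For \<open>k = 0\<close> this means
    \<open>\<gamma> 0 = 1\<close>.\<close>
  have Ag: "A_sum a (Suc k) * \<gamma> k = a (Suc k)" for k
    using A_pos[of k] by (simp add: gamma)
  have Ag1: "A_sum a (Suc k) * (1 - \<gamma> k) = A_sum a k" for k
    using Ag[of k] by (simp add: A_Suc algebra_simps)
  have "\<exists>vbar. \<forall>k. vbar k \<in> edom \<psi> \<and>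
      xbar (Suc k) = (1 - \<gamma> k) *\<^sub>R x k + \<gamma> k *\<^sub>R vbar k \<and>
      (\<forall>v \<in> edom \<psi>. ereal (grad_pairing f (xbar (Suc k)) (v - vbar k)) + \<psi> v
        \<ge> \<psi> (vbar k) - ereal (1 / \<gamma> k * \<delta> (Suc k)))"
    using seq unfolding contracting_point_II_def by (intro choice) blast
  then obtain vbar where vbar: "\<And>k. vbar k \<in> edom \<psi>"
    and xbar: "\<And>k. xbar (Suc k) = (1 - \<gamma> k) *\<^sub>R x k + \<gamma> k *\<^sub>R vbar k"
    and opt: "\<And>k v. v \<in> edom \<psi> \<Longrightarrow> ereal (grad_pairing f (xbar (Suc k)) (v - vbar k)) + \<psi> v
        \<ge> \<psi> (vbar k) - ereal (1 / \<gamma> k * \<delta> (Suc k))"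
    by blast
  have opt_real: "G (Suc k) (v - vbar k) + r v \<ge> r (vbar k) - \<delta> (Suc k) / \<gamma> k"
    if "v \<in> edom \<psi>" for k v
    using opt[OF that, of k] unfolding G_def psi_r[OF that] psi_r[OF vbar] by simp
  have x_Suc: "x (Suc k) =
      (if objective f \<psi> (xbar (Suc k)) \<le> objective f \<psi> (x k) then xbar (Suc k) else x k)" for k
    using seq by (simp add: contracting_point_II_def)
  have x_dom: "x k \<in> edom \<psi>" for k
  proof (induction k)
    case 0
    show ?case using seq by (simp add: contracting_point_II_def)
  next
    case (Suc k)
    then show ?case
      using proper_closed_convex_combination(1)[OF psi Suc vbar[of k], of "\<gamma> k"] g[of k]
      by (simp add: x_Suc xbar)
  qed
  have xbar_dom: "xbar (Suc k) \<in> edom \<psi>" for k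
    unfolding xbar using g[of k] less_imp_le
    by (intro proper_closed_convex_combination(1)[OF psi x_dom vbar]) auto
  have r_xbar: "r (xbar (Suc k)) \<le> (1 - \<gamma> k) * r (x k) + \<gamma> k * r (vbar k)" for k
    unfolding xbar r_def using g[of k] less_imp_le
    by (intro proper_closed_convex_combination(2)[OF psi x_dom vbar]) auto
  \<comment> \<open>Holds in both branches of the acceptance rule, as a test point is rejected only
    when its objective value is larger.\<close>
  have F_Suc: "f (x (Suc k)) + r (x (Suc k)) \<le> f (xbar (Suc k)) + r (xbar (Suc k))" for k
    using psi_r[OF x_dom[of k]] psi_r[OF xbar_dom[of k]] by (auto simp: x_Suc objective_def)
  have der: "(f has_derivative G (Suc k)) (at (xbar (Suc k)))" for k
    unfolding G_def using f_smooth xbar_dom p_ge_1 by (blast intro: cont_diff_at_grad_pairing)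
  have tangent: "f (xbar (Suc k)) + G (Suc k) (x k - xbar (Suc k)) \<le> f (x k)" for k
    by (rule convex_on_ge_tangent[OF f_convex der xbar_dom x_dom])
  have main: "A_sum a k * (f (x k) + r (x k)) - B_sum a \<delta> k \<le> P k v" if v: "v \<in> edom \<psi>" for k v
  proof (induction k)
    case 0
    show ?case by (simp add: A_sum_def B_sum_def P_def)
  next
    case (Suc k)
    define A A' b y where "A = A_sum a k" and "A' = A_sum a (Suc k)" and "b = a (Suc k)"
      and "y = xbar (Suc k)"
    have A': "A' > 0" "A' = A + b" "b > 0" "A \<ge> 0" "A' * \<gamma> k = b" "A' * (1 - \<gamma> k) = A"
      using A_pos A_Suc a_Suc A_nonneg Ag Ag1 by (auto simp: A'_def A_def b_def)
    have lin: "linear (G (Suc k))" by (rule has_derivative_linear[OF der])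
    have "A' *\<^sub>R y = A *\<^sub>R x k + b *\<^sub>R vbar k"
      unfolding y_def xbar scaleR_add_right scaleR_scaleR A'(5,6) ..
    \<comment> \<open>Because \<open>A' = A + b\<close>, the multiples of \<open>y\<close> on the
      left add up to \<open>A' *\<^sub>R y\<close>, which cancels \<open>x k\<close> and leaves
      \<open>vbar k\<close>.\<close>
    then have "A *\<^sub>R (x k - y) + b *\<^sub>R (v - y) = b *\<^sub>R (v - vbar k)"
      unfolding A'(2) by (simp add: algebra_simps)
    then have G_eq: "A * G (Suc k) (x k - y) + b * G (Suc k) (v - y) = b * G (Suc k) (v - vbar k)"
      using linear_add[OF lin, of "A *\<^sub>R (x k - y)" "b *\<^sub>R (v - y)"]
      by (simp add: linear_cmul[OF lin])
    have "b * (r (vbar k) - \<delta> (Suc k) / \<gamma> k) \<le> b * (G (Suc k) (v - vbar k) + r v)"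
      using opt_real[OF v] A'(3) by (intro mult_left_mono) auto
    \<comment> \<open>The factor \<open>1 / \<gamma> k\<close> in the tolerance is absorbed by
      \<open>b = A' * \<gamma> k\<close>, which produces exactly the increment of
      \<open>B_sum\<close>.\<close>
    moreover have "b * (\<delta> (Suc k) / \<gamma> k) = A' * \<delta> (Suc k)"
      using g(1)[of k] A'(5)[symmetric] by simp
    ultimately have 1: "b * r (vbar k) - A' * \<delta> (Suc k) \<le> b * G (Suc k) (v - vbar k) + b * r v"
      by (simp add: algebra_simps)
    have "A' * r y \<le> A' * ((1 - \<gamma> k) * r (x k) + \<gamma> k * r (vbar k))"
      unfolding y_def using r_xbar A'(1) by (intro mult_left_mono) auto
    then have 2: "A' * r y \<le> A * r (x k) + b * r (vbar k)"
      by (simp only: distrib_left mult.assoc[symmetric] A'(5,6))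
    have "A * (f y + G (Suc k) (x k - y)) \<le> A * f (x k)"
      unfolding y_def using tangent A'(4) by (intro mult_left_mono) auto
    then have 3: "A * f y + A * G (Suc k) (x k - y) \<le> A * f (x k)"
      by (simp add: distrib_left)
    have "A' * (f (x (Suc k)) + r (x (Suc k))) \<le> A' * (f y + r y)"
      unfolding y_def using F_Suc A'(1) by (intro mult_left_mono) auto
    then have 4: "A' * (f (x (Suc k)) + r (x (Suc k))) \<le> A * f y + b * f y + A' * r y"
      by (simp add: A'(2) algebra_simps)
    have 5: "P (Suc k) v = P k v + b * f y + b * G (Suc k) (v - y) + b * r v"
      by (simp add: P_def A_Suc b_def y_def algebra_simps)
    have 6: "B_sum a \<delta> (Suc k) = B_sum a \<delta> k + A' * \<delta> (Suc k)"
      by (simp add: B_sum_def A'_def)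
    have 7: "A * f (x k) + A * r (x k) - B_sum a \<delta> k \<le> P k v"
      using Suc by (simp add: A_def distrib_left)
    \<comment> \<open>From the induction hypothesis 7, fact 3 trades \<open>A * f (x k)\<close> for
      the tangent at \<open>y\<close>, \<open>G_eq\<close> merges the gradient terms, 1 removes them
      at the cost of the tolerance, 2 recovers \<open>A' * r y\<close>, and 4 passes from
      \<open>y\<close> to the next iterate.\<close>
    show ?case
      unfolding A'_def[symmetric] using 1 2 3 4 5 6 7 G_eq by linarith
  qed
  have phi_P: "phi f \<psi> a xbar k v = ereal (P k v)" if "v \<in> edom \<psi>" for k v
    unfolding P_def G_def by (rule phi_eq_real, rule psi_r[OF that])
  show ?thesis
  proof (intro allI conjI)
    fix k
    show "\<exists>v \<in> edom \<psi>. phi f \<psi> a xbar k v = phi_star f \<psi> a xbar k"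
    proof (cases k)
      case 0
      have "edom \<psi> \<noteq> {}" using x_dom by blast
      then show ?thesis
        using 0 x_dom[of 0] by (auto simp: phi_star_def phi_def INF_constant)
    next
      case (Suc n)
      have "bounded_linear (grad_pairing f (xbar i))" if "i \<ge> 1" for i
        using has_derivative_bounded_linear[OF der[of "i - 1"]] that by (simp add: G_def)
      then show ?thesis
        using phi_attains_phi_star[OF psi bounded_dom] A_pos Suc by blast
    qed
    have "ereal (A_sum a k) * objective f \<psi> (x k) - ereal (B_sum a \<delta> k)
        = ereal (A_sum a k * (f (x k) + r (x k)) - B_sum a \<delta> k)"
      by (simp add: objective_def psi_r[OF x_dom])
    then show "phi_star f \<psi> a xbar k \<ge> ereal (A_sum a k) * objective f \<psi> (x k) - ereal (B_sum a \<delta> k)"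
      unfolding phi_star_def by (auto intro!: INF_greatest simp: phi_P main)
  qed
qed

end
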